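(* Let $\Gamma$ be a finite simplicial graph such that the right-angled Artin group $A_\Gamma$ is centerless, and let $N\trianglelefteq \mathrm{Aut}(A_\Gamma)$ be a normal subgroup. If $N$ is non-trivial, then $N$ is full-sized.
   Context: For a finite simplicial graph $\Gamma$ with vertex set $V(\Gamma)$ and edge set $E(\Gamma)$, the right-angled Artin group is $A_\Gamma=\langle V(\Gamma)\mid vw=wv \text{ whenever } \{v,w\}\in E(\Gamma)\rangle$. A group is called full-sized if it contains a non-abelian free group $F_2$ (free of rank 2) as a subgroup. Centerless means that the center is trivial. *)

theory Defs
  imports "HOL-Algebra.Coset" "HOL-Algebra.Bij"
begin

section \<open>Groups given by generators and relators\<close>

text \<open>
  A letter \<open>(x, True)\<close> stands for the generator \<open>x\<close> and \<open>(x, False)\<close> for its formal inverse.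
  The group presented by generators \<open>S\<close> and relators \<open>R\<close> consists of the words over
  \<open>S\<close> modulo the least congruence that cancels adjacent inverse letters and deletes relators.
\<close>

type_synonym 'a word = "('a \<times> bool) list"

definition words :: "'a set \<Rightarrow> 'a word set" where
  "words S = lists (S \<times> UNIV)"

definition word_inv :: "'a word \<Rightarrow> 'a word" where
  "word_inv w = rev (map (\<lambda>(x, b). (x, \<not> b)) w)"

inductive pres_eq :: "'a set \<Rightarrow> 'a word set \<Rightarrow> 'a word \<Rightarrow> 'a word \<Rightarrow> bool"
  for S :: "'a set" and R :: "'a word set" where
  refl: "w \<in> words S \<Longrightarrow> pres_eq S R w w"
| sym: "pres_eq S R u v \<Longrightarrow> pres_eq S R v u"
| trans: "pres_eq S R u v \<Longrightarrow> pres_eq S R v w \<Longrightarrow> pres_eq S R u w"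
| cancel: "u \<in> words S \<Longrightarrow> v \<in> words S \<Longrightarrow> x \<in> S \<Longrightarrow>
    pres_eq S R (u @ [(x, b), (x, \<not> b)] @ v) (u @ v)"
| relator: "u \<in> words S \<Longrightarrow> v \<in> words S \<Longrightarrow> r \<in> R \<Longrightarrow> r \<in> words S \<Longrightarrow>
    pres_eq S R (u @ r @ v) (u @ v)"

definition pres_rel :: "'a set \<Rightarrow> 'a word set \<Rightarrow> 'a word rel" where
  "pres_rel S R = {(u, v). pres_eq S R u v}"

definition presented_group :: "'a set \<Rightarrow> 'a word set \<Rightarrow> 'a word set monoid" where
  "presented_group S R =
    \<lparr>carrier = words S // pres_rel S R,
     mult = \<lambda>A B. \<Union>a\<in>A. \<Union>b\<in>B. pres_rel S R `` {a @ b},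
     one = pres_rel S R `` {[]}\<rparr>"

definition free_group :: "'a set \<Rightarrow> 'a word set monoid" where
  "free_group S = presented_group S {}"

definition commutator_word :: "'a \<Rightarrow> 'a \<Rightarrow> 'a word" where
  "commutator_word v w = [(v, True), (w, True), (v, False), (w, False)]"


section \<open>Right-angled Artin groups\<close>

definition finite_simplicial_graph :: "'a set \<Rightarrow> 'a set set \<Rightarrow> bool" where
  "finite_simplicial_graph V E \<longleftrightarrow> finite V \<and> (\<forall>e\<in>E. e \<subseteq> V \<and> card e = 2)"

definition raag :: "'a set \<Rightarrow> 'a set set \<Rightarrow> 'a word set monoid" where
  "raag V E = presented_group V {commutator_word v w | v w. {v, w} \<in> E}"


section \<open>Centerless and full-sized groups\<close>

definition center :: "('a, 'b) monoid_scheme \<Rightarrow> 'a set" where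
  "center G = {z \<in> carrier G. \<forall>g\<in>carrier G. z \<otimes>\<^bsub>G\<^esub> g = g \<otimes>\<^bsub>G\<^esub> z}"

definition centerless :: "('a, 'b) monoid_scheme \<Rightarrow> bool" where
  "centerless G \<longleftrightarrow> center G = {\<one>\<^bsub>G\<^esub>}"

text \<open>The two-element type \<open>bool\<close> serves as the basis of the free group of rank 2.\<close>

definition full_sized :: "('a, 'b) monoid_scheme \<Rightarrow> bool" where
  "full_sized G \<longleftrightarrow>
    (\<exists>H. subgroup H G \<and> free_group (UNIV :: bool set) \<cong> G\<lparr>carrier := H\<rparr>)"


section \<open>Basic facts on presented groups\<close>

lemma words_simps [simp]:
  "[] \<in> words S"
  "a # w \<in> words S \<longleftrightarrow> fst a \<in> S \<and> w \<in> words S"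
  "u @ v \<in> words S \<longleftrightarrow> u \<in> words S \<and> v \<in> words S"
  by (cases a; auto simp: words_def)+

lemma word_inv_simps [simp]:
  "word_inv [] = []"
  "word_inv ((x, b) # w) = word_inv w @ [(x, \<not> b)]"
  by (simp_all add: word_inv_def)

lemma word_inv_words [simp]: "w \<in> words S \<Longrightarrow> word_inv w \<in> words S"
  by (induction w) auto

lemma pres_eq_words: "pres_eq S R u v \<Longrightarrow> u \<in> words S \<and> v \<in> words S"
  by (induction rule: pres_eq.induct) auto

lemma pres_eq_context:
  assumes "pres_eq S R u v" "p \<in> words S" "q \<in> words S"
  shows "pres_eq S R (p @ u @ q) (p @ v @ q)"
  using assms
proof (induction rule: pres_eq.induct)
  case (cancel u v x b)
  then show ?case using pres_eq.cancel[of "p @ u" S "v @ q" x R b] by simp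
next
  case (relator u v r)
  then show ?case using pres_eq.relator[of "p @ u" S "v @ q" r R] by simp
next
  case (trans u v w)
  then show ?case by (blast intro: pres_eq.trans)
qed (simp_all add: pres_eq.refl pres_eq.sym)

lemma pres_eq_append:
  assumes "pres_eq S R u u'" "pres_eq S R v v'"
  shows "pres_eq S R (u @ v) (u' @ v')"
proof -
  have "pres_eq S R (u @ v) (u' @ v)"
    using pres_eq_context[OF assms(1), of "[]" v] pres_eq_words[OF assms(2)] by simp
  moreover have "pres_eq S R (u' @ v) (u' @ v')"
    using pres_eq_context[OF assms(2), of u' "[]"] pres_eq_words[OF assms(1)] by simp
  ultimately show ?thesis by (rule pres_eq.trans)
qed

lemma pres_eq_left_inv: "w \<in> words S \<Longrightarrow> pres_eq S R (word_inv w @ w) []"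
proof (induction w)
  case Nil
  then show ?case by (simp add: pres_eq.refl)
next
  case (Cons a w)
  obtain x b where a: "a = (x, b)" by (cases a)
  have "pres_eq S R (word_inv w @ [(x, \<not> b), (x, \<not> \<not> b)] @ w) (word_inv w @ w)"
    by (rule pres_eq.cancel) (use Cons.prems a in auto)
  then have "pres_eq S R (word_inv (a # w) @ a # w) (word_inv w @ w)"
    by (simp add: a)
  moreover have "pres_eq S R (word_inv w @ w) []" using Cons by simp
  ultimately show ?case by (rule pres_eq.trans)
qed

lemma equiv_pres_rel: "equiv (words S) (pres_rel S R)"
proof (rule equivI)
  show "pres_rel S R \<subseteq> words S \<times> words S"
    by (auto simp: pres_rel_def dest: pres_eq_words)
  show "refl_on (words S) (pres_rel S R)"
    by (simp add: refl_on_def pres_rel_def pres_eq.refl)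
  show "sym (pres_rel S R)"
    by (auto intro: symI pres_eq.sym simp: pres_rel_def)
  show "trans (pres_rel S R)"
    unfolding pres_rel_def by (rule transI) (blast intro: pres_eq.trans)
qed

lemma pres_class_eq_iff:
  "u \<in> words S \<Longrightarrow> v \<in> words S \<Longrightarrow>
    pres_rel S R `` {u} = pres_rel S R `` {v} \<longleftrightarrow> pres_eq S R u v"
  using eq_equiv_class_iff[OF equiv_pres_rel] by (simp add: pres_rel_def)

lemma presented_group_carrier:
  "carrier (presented_group S R) = (\<lambda>w. pres_rel S R `` {w}) ` words S"
  by (auto simp: presented_group_def quotient_def)

lemma presented_group_one: "\<one>\<^bsub>presented_group S R\<^esub> = pres_rel S R `` {[]}"
  by (simp add: presented_group_def)

lemma presented_group_mult:
  assumes "u \<in> words S" "v \<in> words S"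
  shows "pres_rel S R `` {u} \<otimes>\<^bsub>presented_group S R\<^esub> pres_rel S R `` {v} = pres_rel S R `` {u @ v}"
proof -
  have "congruent2 (pres_rel S R) (pres_rel S R) (\<lambda>a b. pres_rel S R `` {a @ b})"
  proof (rule congruent2I')
    fix a a' b b' assume "(a, a') \<in> pres_rel S R" "(b, b') \<in> pres_rel S R"
    then have "pres_eq S R (a @ b) (a' @ b')" by (simp add: pres_rel_def pres_eq_append)
    then show "pres_rel S R `` {a @ b} = pres_rel S R `` {a' @ b'}"
      using pres_eq_words[of S R "a @ b" "a' @ b'"] pres_class_eq_iff[of "a @ b" S "a' @ b'" R] by blast
  qed
  from UN_equiv_class2[OF equiv_pres_rel equiv_pres_rel this assms]
  show ?thesis by (simp add: presented_group_def)
qed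

theorem group_presented_group: "group (presented_group S R)"
proof (rule groupI)
  fix A assume "A \<in> carrier (presented_group S R)"
  then obtain w where w: "w \<in> words S" "A = pres_rel S R `` {w}"
    by (auto simp: presented_group_carrier)
  then show "\<exists>B\<in>carrier (presented_group S R). B \<otimes>\<^bsub>presented_group S R\<^esub> A = \<one>\<^bsub>presented_group S R\<^esub>"
    by (intro bexI[of _ "pres_rel S R `` {word_inv w}"])
      (auto simp: presented_group_carrier presented_group_one presented_group_mult
        pres_class_eq_iff pres_eq_left_inv)
qed (auto simp: presented_group_carrier presented_group_one presented_group_mult)

theorem group_raag: "group (raag V E)"
  by (simp add: raag_def group_presented_group)

theorem group_free_group: "group (free_group S)"
  by (simp add: free_group_def group_presented_group)


subsection \<open>Universal property\<close>

definition word_eval :: "('b, 'c) monoid_scheme \<Rightarrow> ('a \<Rightarrow> 'b) \<Rightarrow> 'a word \<Rightarrow> 'b" where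
  "word_eval G f w =
    foldr (\<lambda>(x, b) g. (if b then f x else inv\<^bsub>G\<^esub> f x) \<otimes>\<^bsub>G\<^esub> g) w \<one>\<^bsub>G\<^esub>"

context group
begin

lemma word_eval_simps [simp]:
  "word_eval G f [] = \<one>"
  "word_eval G f ((x, b) # w) = (if b then f x else inv f x) \<otimes> word_eval G f w"
  by (simp_all add: word_eval_def)

lemma word_eval_closed [simp]:
  "f \<in> S \<rightarrow> carrier G \<Longrightarrow> w \<in> words S \<Longrightarrow> word_eval G f w \<in> carrier G"
  by (induction w) (auto simp: Pi_iff)

lemma word_eval_append:
  "f \<in> S \<rightarrow> carrier G \<Longrightarrow> u \<in> words S \<Longrightarrow> v \<in> words S \<Longrightarrow>
    word_eval G f (u @ v) = word_eval G f u \<otimes> word_eval G f v"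
  by (induction u) (auto simp: m_assoc Pi_iff)

lemma word_eval_pres_eq:
  assumes f: "f \<in> S \<rightarrow> carrier G"
    and R: "\<And>r. r \<in> R \<Longrightarrow> r \<in> words S \<Longrightarrow> word_eval G f r = \<one>"
    and "pres_eq S R u v"
  shows "word_eval G f u = word_eval G f v"
  using assms(3)
proof (induction rule: pres_eq.induct)
  case (cancel u v x b)
  then have "f x \<in> carrier G" "word_eval G f v \<in> carrier G" using f by auto
  then have "word_eval G f ([(x, b), (x, \<not> b)] @ v) = word_eval G f v"
    by (cases b) (simp_all add: m_assoc[symmetric])
  then show ?case using cancel word_eval_append[OF f] by simp
next
  case (relator u v r)
  then show ?case using f R by (simp add: word_eval_append[OF f])
qed auto

theorem presented_group_universal:
  assumes f: "f \<in> S \<rightarrow> carrier G"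
    and R: "\<And>r. r \<in> R \<Longrightarrow> r \<in> words S \<Longrightarrow> word_eval G f r = \<one>"
  shows "\<exists>h \<in> hom (presented_group S R) G.
    \<forall>w\<in>words S. h (pres_rel S R `` {w}) = word_eval G f w"
proof -
  define h where "h A = word_eval G f (SOME w. w \<in> A)" for A
  have h: "h (pres_rel S R `` {w}) = word_eval G f w" if "w \<in> words S" for w
  proof -
    have "w \<in> pres_rel S R `` {w}" using that by (simp add: pres_rel_def pres_eq.refl)
    then have "(SOME v. v \<in> pres_rel S R `` {w}) \<in> pres_rel S R `` {w}" by (rule someI)
    then have "pres_eq S R w (SOME v. v \<in> pres_rel S R `` {w})" by (simp add: pres_rel_def)
    from word_eval_pres_eq[OF f R this] show ?thesis by (simp add: h_def)
  qed
  moreover have "h \<in> hom (presented_group S R) G"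
    by (rule homI)
      (use f in \<open>auto simp: presented_group_carrier presented_group_mult h word_eval_append\<close>)
  ultimately show ?thesis by blast
qed

end

end

theory Submission
  imports Defs "HOL.Rat"
begin

text \<open>
  Write \<open>A\<close> for the right-angled Artin group. The proof moves the question from automorphisms to
  \<open>A\<close>, and then to a free group sitting inside \<open>A\<close>.

  For \<open>\<phi>\<close> in \<open>N\<close> and \<open>g\<close> in \<open>A\<close>, the commutator of \<open>\<phi>\<close> with conjugation by \<open>g\<close> lies in \<open>N\<close>, and it
  is conjugation by \<open>\<phi>(g) g\<inverse>\<close>. Hence the elements of \<open>A\<close> whose conjugation lies in \<open>N\<close> form a
  non-trivial normal subgroup \<open>M\<close> of \<open>A\<close> (\<open>nontrivial_vimage_inner\<close>). Since \<open>A\<close> is centerless, \<open>M\<close>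
  embeds into \<open>N\<close>, so a free group of rank 2 inside \<open>M\<close> is enough.

  Fix a vertex \<open>v\<close>. Let \<open>B\<close> be the subgroup generated by the other vertices, and \<open>X\<close> the set of
  conjugates of \<open>v\<close> by elements of \<open>B\<close>. Then \<open>A\<close> is the semidirect product \<open>F(X) \<rtimes> B\<close>: the only
  relators that involve \<open>v\<close> say that some vertices of \<open>B\<close> commute with \<open>v\<close>, and such a relation is
  already visible in the set \<open>X\<close>, on which \<open>B\<close> acts by conjugation. This is proved by letting \<open>A\<close> act
  on reduced words: \<open>v\<close> acts by left multiplication with the letter \<open>v\<close>, the other vertices by
  conjugating each letter. Applied to the empty word, an element \<open>f b\<close> with \<open>f\<close> in \<open>F(X)\<close> and \<open>b\<close> in
  \<open>B\<close> gives the reduced word of \<open>f\<close> (\<open>word_act_normal_form\<close>, \<open>word_value_eq_one_iff\<close>).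

  Take \<open>h \<noteq> 1\<close> in \<open>M\<close> and let \<open>v\<close> be the first letter of a shortest word for \<open>h\<close>; deleting all \<open>v\<close>
  from this word changes the element, so in \<open>h = f b\<close> the part \<open>f\<close> is non-trivial. As \<open>A\<close> is
  centerless, some vertex is not adjacent to \<open>v\<close>, which makes \<open>X\<close> infinite
  (\<open>infinite_vertex_conjugates\<close>). For generic \<open>x\<close> in \<open>X\<close> the commutator of \<open>h\<close> with \<open>x\<close> is
  \<open>f (b x b\<inverse>) f\<inverse> x\<inverse>\<close>, a reduced word, hence a non-trivial element \<open>k\<close> of \<open>M\<close> inside \<open>F(X)\<close>. For
  generic \<open>y\<close> and \<open>z\<close> in \<open>X\<close> the elements \<open>(y k y\<inverse>)(z k z\<inverse>)\<close> and \<open>(y\<inverse> k y)(z\<inverse> k z)\<close> of \<open>M\<close> are free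
  generators, because nothing cancels in a reduced product of these words and their inverses
  (\<open>reduced_substitution\<close>).
\<close>

section \<open>Reduced words\<close>

definition flip :: "'a \<times> bool \<Rightarrow> 'a \<times> bool" where
  "flip l = (fst l, \<not> snd l)"

lemma flip_simps [simp]:
  "flip (x, b) = (x, \<not> b)" "fst (flip l) = fst l" "snd (flip l) = (\<not> snd l)"
  "flip (flip l) = l" "flip l \<noteq> l" "l \<noteq> flip l" "flip l = flip k \<longleftrightarrow> l = k"
  by (auto simp: flip_def prod_eq_iff)

definition reduced :: "'a word \<Rightarrow> bool" where
  "reduced = successively (\<lambda>k l. l \<noteq> flip k)"

lemma reduced_simps [simp]:
  "reduced []"
  "reduced (l # w) \<longleftrightarrow> (w = [] \<or> hd w \<noteq> flip l) \<and> reduced w"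
  by (auto simp: reduced_def successively_Cons)

lemma reduced_append_iff:
  "reduced (u @ w) \<longleftrightarrow> reduced u \<and> reduced w \<and> (u = [] \<or> w = [] \<or> hd w \<noteq> flip (last u))"
  by (auto simp: reduced_def successively_append_iff)

lemma word_inv_eq_rev_flip: "word_inv w = rev (map flip w)"
  by (induction w) auto

lemma word_inv_eq_Nil_iff [simp]: "word_inv w = [] \<longleftrightarrow> w = []"
  by (simp add: word_inv_eq_rev_flip)

lemma hd_word_inv: "w \<noteq> [] \<Longrightarrow> hd (word_inv w) = flip (last w)"
  by (simp add: word_inv_eq_rev_flip hd_rev last_map)

lemma last_word_inv: "w \<noteq> [] \<Longrightarrow> last (word_inv w) = flip (hd w)"
  by (simp add: word_inv_eq_rev_flip last_rev hd_map)

lemma reduced_word_inv [simp]: "reduced (word_inv w) \<longleftrightarrow> reduced w"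
proof -
  have "successively (\<lambda>k l. k \<noteq> flip l) w \<longleftrightarrow> successively (\<lambda>k l. l \<noteq> flip k) w"
    by (rule successively_cong) auto
  then show ?thesis by (simp add: word_inv_eq_rev_flip reduced_def successively_map)
qed

text \<open>
  On reduced words this is left multiplication by a letter in the free group.
\<close>

definition push :: "'a \<times> bool \<Rightarrow> 'a word \<Rightarrow> 'a word" where
  "push l f = (if f \<noteq> [] \<and> hd f = flip l then tl f else l # f)"

lemma push_closed: "fst l \<in> S \<Longrightarrow> f \<in> words S \<Longrightarrow> push l f \<in> words S"
  by (cases f) (auto simp: push_def)

lemma reduced_push: "reduced f \<Longrightarrow> reduced (push l f)"
  by (cases f) (auto simp: push_def)

lemma push_flip: "reduced f \<Longrightarrow> push l (push (flip l) f) = f"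
  by (cases f; cases "tl f") (auto simp: push_def)

lemma push_eq_Cons: "reduced (l # f) \<Longrightarrow> push l f = l # f"
  by (auto simp: push_def)

definition letter_image :: "('b \<Rightarrow> 'a word) \<Rightarrow> 'b \<times> bool \<Rightarrow> 'a word" where
  "letter_image \<alpha> l = (if snd l then \<alpha> (fst l) else word_inv (\<alpha> (fst l)))"

lemma letter_image_flip: "letter_image \<alpha> (flip l) = word_inv (letter_image \<alpha> l)"
  by (simp add: letter_image_def word_inv_eq_rev_flip rev_map comp_def)

text \<open>
  A cancellation between the images of adjacent letters \<open>l\<close> and \<open>m\<close> would start at the junction,
  where the last letter of the image of \<open>l\<close> would be the inverse of the first letter of the image
  of \<open>m\<close>. This inverse is the last letter of the image of \<open>m\<inverse>\<close>, so distinct last letters leave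
  only \<open>m = l\<inverse>\<close>, which a reduced word excludes.
\<close>

lemma reduced_substitution:
  assumes ne: "\<And>i. \<alpha> i \<noteq> []" and red: "\<And>i. reduced (\<alpha> i)"
    and inj: "inj (\<lambda>l. last (letter_image \<alpha> l))"
    and r: "reduced r"
  shows "reduced (concat (map (letter_image \<alpha>) r))"
proof -
  have ne': "letter_image \<alpha> l \<noteq> []" for l using ne by (simp add: letter_image_def)
  have hd_concat: "hd (concat (map (letter_image \<alpha>) s)) = hd (letter_image \<alpha> (hd s))" if "s \<noteq> []" for s
    using that ne' by (cases s) auto
  have hd_eq: "hd (letter_image \<alpha> l) = flip (last (letter_image \<alpha> (flip l)))" for l
    using ne' by (simp add: letter_image_flip last_word_inv)
  show ?thesis
    using r
  proof (induction r)
    case (Cons l r)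
    have "reduced (letter_image \<alpha> l)" using red by (simp add: letter_image_def)
    moreover have "hd (concat (map (letter_image \<alpha>) r)) \<noteq> flip (last (letter_image \<alpha> l))" if "r \<noteq> []"
      using that Cons.prems injD[OF inj, of "flip (hd r)" l] by (auto simp: hd_concat hd_eq)
    ultimately show ?case using Cons by (cases "r = []") (simp_all add: reduced_append_iff)
  qed simp
qed

section \<open>Words and their values in groups\<close>

lemma (in group) word_eval_word_inv:
  assumes "f \<in> S \<rightarrow> carrier G" "w \<in> words S"
  shows "word_eval G f (word_inv w) = inv (word_eval G f w)"
  using assms(2)
proof (induction w)
  case (Cons l w)
  obtain x b where l: "l = (x, b)" by (cases l)
  have "f x \<in> carrier G" "word_eval G f w \<in> carrier G" using Cons.prems assms(1) l by auto
  then show ?case using Cons l assms(1)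
    by (simp add: word_eval_append[OF assms(1)] inv_mult_group)
qed simp

lemma presented_group_inv:
  assumes "w \<in> words S"
  shows "inv\<^bsub>presented_group S R\<^esub> (pres_rel S R `` {w}) = pres_rel S R `` {word_inv w}"
  by (rule group.inv_equality[OF group_presented_group])
    (use assms in \<open>auto simp: presented_group_carrier presented_group_mult presented_group_one
      pres_class_eq_iff pres_eq_left_inv\<close>)

lemma ex_shortest_word:
  assumes "C \<in> carrier (presented_group S R)"
  obtains w where "w \<in> words S" "C = pres_rel S R `` {w}"
    "\<And>u. u \<in> words S \<Longrightarrow> C = pres_rel S R `` {u} \<Longrightarrow> length w \<le> length u"
proof -
  obtain w0 where "w0 \<in> words S \<and> C = pres_rel S R `` {w0}"
    using assms by (auto simp: presented_group_carrier)
  from ex_has_least_nat[where P = "\<lambda>w. w \<in> words S \<and> C = pres_rel S R `` {w}" and m = length, OF this] that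
  show thesis by blast
qed

text \<open>
  A shortest representative cannot contain adjacent inverse letters, since deleting them gives a
  shorter one.
\<close>

lemma ex_reduced_word:
  assumes "C \<in> carrier (presented_group S R)"
  obtains w where "w \<in> words S" "C = pres_rel S R `` {w}" "reduced w"
proof -
  obtain w where w: "w \<in> words S" "C = pres_rel S R `` {w}"
    and least: "\<And>u. u \<in> words S \<Longrightarrow> C = pres_rel S R `` {u} \<Longrightarrow> length w \<le> length u"
    using ex_shortest_word[OF assms] by blast
  have "reduced w"
  proof (rule ccontr)
    assume "\<not> reduced w"
    then obtain u l u' where dec: "w = u @ [l, flip l] @ u'"
    proof (induction w arbitrary: thesis)
      case (Cons k w)
      show ?case
      proof (cases "reduced w")
        case True
        with Cons.prems(2) obtain w' where "w = flip k # w'" by (cases w) auto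
        then show ?thesis using Cons.prems(1)[of "[]" k w'] by simp
      next
        case False
        then obtain u l u' where "w = u @ [l, flip l] @ u'" using Cons.IH by blast
        then show ?thesis using Cons.prems(1)[of "k # u" l u'] by simp
      qed
    qed simp
    obtain x b where l: "l = (x, b)" by (cases l)
    have uu': "u \<in> words S" "u' \<in> words S" "x \<in> S" using w(1) dec l by auto
    then have "pres_eq S R w (u @ u')" using pres_eq.cancel[of u S u' x R b] dec l by simp
    then have "C = pres_rel S R `` {u @ u'}" using w uu' by (simp add: pres_class_eq_iff)
    from least[OF _ this] uu' dec show False by simp
  qed
  with w that show thesis by blast
qed

text \<open>
  The universal property of a right-angled Artin group, at the level of words: an assignment of
  group elements to the vertices that respects the commutation relations is well defined on
  group elements.
\<close>

lemma (in group) word_eval_raag_cong: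
  assumes f: "f \<in> V \<rightarrow> carrier G"
    and comm: "\<And>s t. {s, t} \<in> E \<Longrightarrow> s \<in> V \<Longrightarrow> t \<in> V \<Longrightarrow> f s \<otimes> f t = f t \<otimes> f s"
    and eq: "pres_eq V {commutator_word v w | v w. {v, w} \<in> E} u u'"
  shows "word_eval G f u = word_eval G f u'"
proof (rule word_eval_pres_eq[OF f _ eq])
  fix r assume "r \<in> {commutator_word v w | v w. {v, w} \<in> E}" "r \<in> words V"
  then obtain s t where r: "r = commutator_word s t" and st: "{s, t} \<in> E" "s \<in> V" "t \<in> V"
    by (auto simp: commutator_word_def)
  then have c: "f s \<in> carrier G" "f t \<in> carrier G" using f by auto
  have "word_eval G f r = (f s \<otimes> f t) \<otimes> inv (f t \<otimes> f s)"
    using c by (simp add: r commutator_word_def inv_mult_group m_assoc)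
  also have "\<dots> = \<one>" using c comm[OF st] by simp
  finally show "word_eval G f r = \<one>" .
qed

lemma (in group) ex_nontrivial_element:
  assumes "subgroup H G" "H \<noteq> {\<one>}"
  shows "\<exists>x\<in>H. x \<noteq> \<one>"
  using assms subgroup.one_closed[OF assms(1)] by blast

lemma (in group) word_eval_subgroup:
  assumes "subgroup H G" "f \<in> S \<rightarrow> H" "w \<in> words S"
  shows "word_eval G f w \<in> H"
  using assms(3)
proof (induction w)
  case Nil
  then show ?case using assms(1) by (simp add: subgroup.one_closed)
next
  case (Cons l w)
  obtain x b where l: "l = (x, b)" by (cases l)
  then have "f x \<in> H" using Cons.prems assms(2) by auto
  then show ?case using Cons l assms(1) by (auto simp: subgroup.m_closed subgroup.m_inv_closed)
qed

text \<open>
  The assignment \<open>\<lambda>x. x\<close> reads a word over the group itself as a product.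
\<close>

lemma (in group) word_eval_substitution:
  assumes \<alpha>: "\<And>i. \<alpha> i \<in> words (carrier G)"
  shows "word_eval G (\<lambda>i. word_eval G (\<lambda>x. x) (\<alpha> i)) s
    = word_eval G (\<lambda>x. x) (concat (map (letter_image \<alpha>) s))"
proof (induction s)
  case (Cons l s)
  have id: "(\<lambda>x. x) \<in> carrier G \<rightarrow> carrier G" by auto
  have im: "letter_image \<alpha> l \<in> words (carrier G)" for l using \<alpha> by (simp add: letter_image_def)
  have cc: "concat (map (letter_image \<alpha>) s) \<in> words (carrier G)" using im by (induction s) auto
  have "word_eval G (\<lambda>x. x) (letter_image \<alpha> l)
      = (if snd l then word_eval G (\<lambda>x. x) (\<alpha> (fst l)) else inv (word_eval G (\<lambda>x. x) (\<alpha> (fst l))))"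
    using \<alpha> by (simp add: letter_image_def word_eval_word_inv[OF id])
  then show ?case using Cons by (cases l) (simp add: word_eval_append[OF id im cc])
qed simp

section \<open>Conjugation\<close>

definition conjugate :: "('a, 'b) monoid_scheme \<Rightarrow> 'a \<Rightarrow> 'a \<Rightarrow> 'a" where
  "conjugate G g x = g \<otimes>\<^bsub>G\<^esub> x \<otimes>\<^bsub>G\<^esub> inv\<^bsub>G\<^esub> g"

definition conj_word :: "('a, 'b) monoid_scheme \<Rightarrow> 'a \<Rightarrow> 'a word \<Rightarrow> 'a word" where
  "conj_word G g = map (apfst (conjugate G g))"

context group
begin

lemma conjugate_closed [simp]: "g \<in> carrier G \<Longrightarrow> x \<in> carrier G \<Longrightarrow> conjugate G g x \<in> carrier G"
  by (simp add: conjugate_def)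

lemma conjugate_one: "x \<in> carrier G \<Longrightarrow> conjugate G \<one> x = x"
  by (simp add: conjugate_def)

lemma conjugate_mult:
  "g \<in> carrier G \<Longrightarrow> h \<in> carrier G \<Longrightarrow> x \<in> carrier G \<Longrightarrow> conjugate G (g \<otimes> h) x = conjugate G g (conjugate G h x)"
  by (simp add: conjugate_def m_assoc inv_mult_group)

lemma conjugate_hom:
  "g \<in> carrier G \<Longrightarrow> x \<in> carrier G \<Longrightarrow> y \<in> carrier G \<Longrightarrow> conjugate G g (x \<otimes> y) = conjugate G g x \<otimes> conjugate G g y"
  unfolding conjugate_def by (metis inv_closed inv_solve_left' m_assoc m_closed)

lemma conjugate_inv:
  "g \<in> carrier G \<Longrightarrow> x \<in> carrier G \<Longrightarrow> conjugate G g (inv x) = inv (conjugate G g x)"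
  by (simp add: conjugate_def inv_mult_group m_assoc)

lemma conjugate_inv_cancel:
  "g \<in> carrier G \<Longrightarrow> x \<in> carrier G \<Longrightarrow> conjugate G g (conjugate G (inv g) x) = x"
  "g \<in> carrier G \<Longrightarrow> x \<in> carrier G \<Longrightarrow> conjugate G (inv g) (conjugate G g x) = x"
  by (simp_all add: conjugate_mult[symmetric] conjugate_one)

lemma conjugate_eq_iff:
  "g \<in> carrier G \<Longrightarrow> x \<in> carrier G \<Longrightarrow> y \<in> carrier G \<Longrightarrow> conjugate G g x = conjugate G g y \<longleftrightarrow> x = y"
  by (metis conjugate_inv_cancel(2))

lemma conjugate_eq_self_iff:
  "g \<in> carrier G \<Longrightarrow> x \<in> carrier G \<Longrightarrow> conjugate G g x = x \<longleftrightarrow> g \<otimes> x = x \<otimes> g"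
  by (metis conjugate_def inv_solve_right m_closed)

lemma conj_word_simps [simp]:
  "conj_word G g [] = []"
  "conj_word G g (l # f) = (conjugate G g (fst l), snd l) # conj_word G g f"
  by (cases l; simp add: conj_word_def)+

lemma conj_word_closed: "g \<in> carrier G \<Longrightarrow> f \<in> words (carrier G) \<Longrightarrow> conj_word G g f \<in> words (carrier G)"
  by (induction f) auto

lemma conj_word_one: "f \<in> words (carrier G) \<Longrightarrow> conj_word G \<one> f = f"
  by (induction f) (auto simp: conjugate_one)

lemma conj_word_mult:
  "g \<in> carrier G \<Longrightarrow> h \<in> carrier G \<Longrightarrow> f \<in> words (carrier G) \<Longrightarrow>
    conj_word G (g \<otimes> h) f = conj_word G g (conj_word G h f)"
  by (induction f) (auto simp: conjugate_mult)

lemma conj_word_push: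
  assumes "g \<in> carrier G" "fst l \<in> carrier G" "f \<in> words (carrier G)"
  shows "conj_word G g (push l f) = push (conjugate G g (fst l), snd l) (conj_word G g f)"
  using assms by (cases f) (auto simp: push_def prod_eq_iff conjugate_eq_iff)

lemma reduced_conj_word:
  assumes "g \<in> carrier G" "f \<in> words (carrier G)" "reduced f"
  shows "reduced (conj_word G g f)"
  using assms(2,3)
proof (induction f)
  case (Cons l f)
  then show ?case using assms(1) by (cases f) (auto simp: prod_eq_iff conjugate_eq_iff)
qed simp

lemma word_eval_conj_word:
  assumes "g \<in> carrier G" "f \<in> words (carrier G)"
  shows "word_eval G (\<lambda>x. x) (conj_word G g f) = conjugate G g (word_eval G (\<lambda>x. x) f)"
  using assms(2)
proof (induction f)
  case Nil
  then show ?case using assms(1) by (simp add: conjugate_def)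
next
  case (Cons l f)
  obtain x b where l: "l = (x, b)" by (cases l)
  have x: "x \<in> carrier G" using Cons.prems l by simp
  have "word_eval G (\<lambda>x. x) f \<in> carrier G"
    using Cons.prems by (intro word_eval_closed[where S = "carrier G"]) auto
  with Cons x l assms(1) show ?case by (simp add: conjugate_hom conjugate_inv)
qed

lemma word_eval_push:
  assumes "x \<in> carrier G" "f \<in> words (carrier G)"
  shows "word_eval G (\<lambda>x. x) (push (x, b) f) = (if b then x else inv x) \<otimes> word_eval G (\<lambda>x. x) f"
proof (cases f)
  case (Cons k f')
  obtain y c where k: "k = (y, c)" by (cases k)
  have "word_eval G (\<lambda>x. x) f' \<in> carrier G"
    using assms Cons by (intro word_eval_closed[where S = "carrier G"]) auto
  then show ?thesis using assms Cons k by (auto simp: push_def m_assoc[symmetric])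
qed (simp add: push_def)

end

section \<open>A right-angled Artin group acting on reduced words over itself\<close>

locale raag_vertex =
  fixes V :: "'a set" and E :: "'a set set" and v :: 'a
  assumes v: "v \<in> V"
begin

abbreviation A :: "'a word set monoid" where
  "A \<equiv> raag V E"

abbreviation relators :: "'a word set" where
  "relators \<equiv> {commutator_word v w | v w. {v, w} \<in> E}"

definition elt :: "'a word \<Rightarrow> 'a word set" where
  "elt w = pres_rel V relators `` {w}"

sublocale A: group A
  by (rule group_raag)

lemma elt_closed: "w \<in> words V \<Longrightarrow> elt w \<in> carrier A"
  by (auto simp: elt_def raag_def presented_group_carrier)

lemma elt_append: "u \<in> words V \<Longrightarrow> w \<in> words V \<Longrightarrow> elt (u @ w) = elt u \<otimes>\<^bsub>A\<^esub> elt w"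
  by (simp add: elt_def raag_def presented_group_mult)

lemma elt_Cons: "l # w \<in> words V \<Longrightarrow> elt (l # w) = elt [l] \<otimes>\<^bsub>A\<^esub> elt w"
  using elt_append[of "[l]" w] by simp

lemma elt_Nil: "elt [] = \<one>\<^bsub>A\<^esub>"
  by (simp add: elt_def raag_def presented_group_one)

lemma elt_word_inv: "w \<in> words V \<Longrightarrow> elt (word_inv w) = inv\<^bsub>A\<^esub> elt w"
  by (simp add: elt_def raag_def presented_group_inv)

lemma elt_eq_iff: "u \<in> words V \<Longrightarrow> w \<in> words V \<Longrightarrow> elt u = elt w \<longleftrightarrow> pres_eq V relators u w"
  by (simp add: elt_def pres_class_eq_iff)

lemma elt_flip: "fst l \<in> V \<Longrightarrow> elt [flip l] = inv\<^bsub>A\<^esub> elt [l]"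
  using elt_word_inv[of "[l]"] by (cases l) simp

lemma elt_edge_commute:
  assumes "{s, t} \<in> E" "s \<in> V" "t \<in> V"
  shows "elt [(s, True)] \<otimes>\<^bsub>A\<^esub> elt [(t, True)] = elt [(t, True)] \<otimes>\<^bsub>A\<^esub> elt [(s, True)]"
proof -
  let ?s = "elt [(s, True)]" and ?t = "elt [(t, True)]"
  have c: "?s \<in> carrier A" "?t \<in> carrier A" using assms by (simp_all add: elt_closed)
  have "pres_eq V relators ([] @ commutator_word s t @ []) ([] @ [])"
    by (rule pres_eq.relator) (use assms in \<open>auto simp: commutator_word_def\<close>)
  then have "elt (commutator_word s t) = \<one>\<^bsub>A\<^esub>"
    using assms by (subst elt_Nil[symmetric], subst elt_eq_iff) (simp_all add: commutator_word_def)
  then have "?s \<otimes>\<^bsub>A\<^esub> (?t \<otimes>\<^bsub>A\<^esub> (inv\<^bsub>A\<^esub> ?s \<otimes>\<^bsub>A\<^esub> inv\<^bsub>A\<^esub> ?t)) = \<one>\<^bsub>A\<^esub>"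
    using assms elt_flip[of "(s, True)"] elt_flip[of "(t, True)"]
    by (simp add: commutator_word_def elt_Cons[of _ "_ # _"])
  then have "(?s \<otimes>\<^bsub>A\<^esub> ?t) \<otimes>\<^bsub>A\<^esub> inv\<^bsub>A\<^esub> (?t \<otimes>\<^bsub>A\<^esub> ?s) = \<one>\<^bsub>A\<^esub>"
    using c by (simp add: A.inv_mult_group A.m_assoc)
  then show ?thesis using c by (metis A.inv_solve_right' A.l_one A.m_closed A.one_closed)
qed

text \<open>
  The words acted on have elements of \<open>A\<close> as letters, so that the vertices other than \<open>v\<close> can act by
  conjugating every letter. Starting from the empty word only conjugates of \<open>v\<close> occur as letters.
\<close>

definition letter_act :: "'a \<times> bool \<Rightarrow> 'a word set word \<Rightarrow> 'a word set word" where
  "letter_act l f =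
    (if fst l = v then push (elt [(v, True)], snd l) f else conj_word A (elt [l]) f)"

definition word_act :: "'a word \<Rightarrow> 'a word set word \<Rightarrow> 'a word set word" where
  "word_act = foldr letter_act"

lemma word_act_simps [simp]:
  "word_act [] f = f" "word_act (l # w) f = letter_act l (word_act w f)"
  "word_act (u @ w) f = word_act u (word_act w f)"
  by (simp_all add: word_act_def)

abbreviation reduced_words :: "'a word set word set" where
  "reduced_words \<equiv> {f \<in> words (carrier A). reduced f}"

lemma letter_act_closed: "fst l \<in> V \<Longrightarrow> f \<in> reduced_words \<Longrightarrow> letter_act l f \<in> reduced_words"
  using v by (auto simp: letter_act_def A.conj_word_closed A.reduced_conj_word push_closed
    reduced_push elt_closed)

lemma word_act_closed: "w \<in> words V \<Longrightarrow> f \<in> reduced_words \<Longrightarrow> word_act w f \<in> reduced_words"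
  by (induction w) (use letter_act_closed in \<open>auto simp del: mem_Collect_eq\<close>)

lemma letter_act_flip:
  assumes "fst l \<in> V" "f \<in> reduced_words"
  shows "letter_act l (letter_act (flip l) f) = f"
proof (cases "fst l = v")
  case True
  then show ?thesis
    using assms push_flip[of f "(elt [(v, True)], snd l)"] by (simp add: letter_act_def)
next
  case False
  then show ?thesis using assms elt_closed[of "[l]"]
    by (simp add: letter_act_def elt_flip A.conj_word_mult[symmetric] A.conj_word_one)
qed

text \<open>
  If \<open>s\<close> is adjacent to \<open>v\<close>, conjugation by \<open>s\<close> fixes the letter \<open>v\<close> and therefore commutes with
  pushing it; two vertices other than \<open>v\<close> commute already as elements of \<open>A\<close>.
\<close>

lemma letter_act_commute:
  assumes "{s, t} \<in> E" "s \<in> V" "t \<in> V" "f \<in> reduced_words"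
  shows "letter_act (s, True) (letter_act (t, True) f) = letter_act (t, True) (letter_act (s, True) f)"
proof -
  let ?s = "elt [(s, True)]" and ?t = "elt [(t, True)]"
  have c: "?s \<in> carrier A" "?t \<in> carrier A" using assms by (simp_all add: elt_closed)
  have comm: "?s \<otimes>\<^bsub>A\<^esub> ?t = ?t \<otimes>\<^bsub>A\<^esub> ?s" by (rule elt_edge_commute) (use assms in auto)
  then have "conjugate A ?s ?t = ?t" "conjugate A ?t ?s = ?s"
    using c by (simp_all add: A.conjugate_eq_self_iff)
  moreover have "conj_word A ?s (conj_word A ?t f) = conj_word A ?t (conj_word A ?s f)"
    using c assms comm by (simp add: A.conj_word_mult[symmetric])
  ultimately show ?thesis using c assms by (auto simp: letter_act_def A.conj_word_push)
qed

text \<open>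
  The action is one of \<open>A\<close>, not only of words: the inverse letters undo each other by
  \<open>letter_act_flip\<close>, and the commutator relators act trivially by \<open>letter_act_commute\<close>.
\<close>

lemma word_act_pres_eq:
  assumes "pres_eq V relators u u'" "f \<in> reduced_words"
  shows "word_act u f = word_act u' f"
  using assms
proof (induction rule: pres_eq.induct)
  case (cancel u w x b)
  then show ?case using letter_act_flip[of "(x, b)" "word_act w f"] word_act_closed[of w f] by simp
next
  case (relator u w r)
  then obtain s t where r: "r = commutator_word s t" "{s, t} \<in> E" by blast
  then have st: "s \<in> V" "t \<in> V" using relator.hyps(4) by (auto simp: commutator_word_def)
  define g where "g = word_act w f"
  have g: "g \<in> reduced_words" unfolding g_def using relator.hyps relator.prems by (intro word_act_closed) auto
  define g' where "g' = letter_act (s, False) (letter_act (t, False) g)"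
  have cl: "letter_act (t, False) g \<in> reduced_words" using g st by (intro letter_act_closed) auto
  have g': "g' \<in> reduced_words" using letter_act_closed[OF _ cl, of "(s, False)"] st by (simp add: g'_def)
  have "letter_act (s, True) (letter_act (t, True) g') = letter_act (t, True) (letter_act (s, True) g')"
    using r st g' by (intro letter_act_commute) auto
  also have "\<dots> = g"
    using letter_act_flip[of "(s, True)", OF _ cl] letter_act_flip[of "(t, True)", OF _ g] st
    by (simp add: g'_def)
  finally show ?case by (simp add: r g'_def g_def commutator_word_def)
qed auto

lemma word_act_avoid:
  assumes "p \<in> words (V - {v})" "f \<in> words (carrier A)"
  shows "word_act p f = conj_word A (elt p) f"
  using assms(1)
proof (induction p)
  case Nil
  then show ?case using assms(2) by (simp add: elt_Nil A.conj_word_one)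
next
  case (Cons l p)
  have "p \<in> words V" using Cons.prems by (auto simp: words_def)
  with Cons assms(2) show ?case
    by (simp add: letter_act_def elt_Cons[of l p] elt_closed A.conj_word_mult)
qed

section \<open>The conjugates of a vertex are free generators\<close>

definition vertex_conjugates :: "'a word set set" where
  "vertex_conjugates = {conjugate A (elt p) (elt [(v, True)]) | p. p \<in> words (V - {v})}"

abbreviation word_value :: "'a word set word \<Rightarrow> 'a word set" where
  "word_value \<equiv> word_eval A (\<lambda>x. x)"

lemma words_Diff: "p \<in> words (V - {v}) \<Longrightarrow> p \<in> words V"
  by (auto simp: words_def)

lemma vertex_conjugates_closed: "vertex_conjugates \<subseteq> carrier A"
  using v by (auto simp: vertex_conjugates_def elt_closed words_Diff)

lemma words_vertex_conjugates: "f \<in> words vertex_conjugates \<Longrightarrow> f \<in> words (carrier A)"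
  using vertex_conjugates_closed by (auto simp: words_def)

lemma word_value_closed: "f \<in> words vertex_conjugates \<Longrightarrow> word_value f \<in> carrier A"
  using vertex_conjugates_closed by (intro A.word_eval_closed[where S = vertex_conjugates]) auto

lemma v_in_vertex_conjugates: "elt [(v, True)] \<in> vertex_conjugates"
proof -
  have "conjugate A (elt []) (elt [(v, True)]) = elt [(v, True)]"
    using v by (simp add: elt_Nil A.conjugate_one elt_closed)
  then show ?thesis unfolding vertex_conjugates_def by (auto intro!: exI[of _ "[]"])
qed

lemma conjugate_vertex_conjugates:
  assumes "p \<in> words (V - {v})" "x \<in> vertex_conjugates"
  shows "conjugate A (elt p) x \<in> vertex_conjugates"
proof -
  obtain q where q: "q \<in> words (V - {v})" "x = conjugate A (elt q) (elt [(v, True)])"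
    using assms(2) by (auto simp: vertex_conjugates_def)
  then have "conjugate A (elt p) x = conjugate A (elt (p @ q)) (elt [(v, True)])"
    using assms(1) v by (simp add: elt_append elt_closed words_Diff A.conjugate_mult)
  then show ?thesis using assms(1) q(1) unfolding vertex_conjugates_def by (intro CollectI exI[of _ "p @ q"]) auto
qed

text \<open>
  The decomposition of an element along \<open>F(X) \<rtimes> B\<close>, where \<open>X\<close> is \<open>vertex_conjugates\<close> and \<open>B\<close> is
  generated by the vertices other than \<open>v\<close>. Deleting the letters \<open>v\<close> projects onto \<open>B\<close>, and the image
  of the empty word under the action is the part in \<open>F(X)\<close>: a further letter \<open>v\<close> multiplies this part,
  and any other letter \<open>s\<close> is moved past it, which conjugates it by \<open>s\<close>.
\<close>

lemma word_act_normal_form: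
  assumes "w \<in> words V"
  shows "word_act w [] \<in> words vertex_conjugates"
    and "elt w = word_value (word_act w []) \<otimes>\<^bsub>A\<^esub> elt (filter (\<lambda>l. fst l \<noteq> v) w)"
proof -
  have "word_act w [] \<in> words vertex_conjugates \<and>
      elt w = word_value (word_act w []) \<otimes>\<^bsub>A\<^esub> elt (filter (\<lambda>l. fst l \<noteq> v) w)"
    using assms
  proof (induction w)
    case Nil
    then show ?case by (simp add: elt_Nil)
  next
    case (Cons l w)
    define f where "f = word_act w []"
    define c where "c = elt (filter (\<lambda>l. fst l \<noteq> v) w)"
    have l: "fst l \<in> V" "elt [l] \<in> carrier A" and w: "w \<in> words V" using Cons.prems by (auto simp: elt_closed)
    have filt: "filter (\<lambda>l. fst l \<noteq> v) w \<in> words V" using w by (auto simp: words_def)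
    have c: "c \<in> carrier A" unfolding c_def using filt by (rule elt_closed)
    have f: "f \<in> words vertex_conjugates" and dec: "elt w = word_value f \<otimes>\<^bsub>A\<^esub> c"
      using Cons by (auto simp: f_def c_def)
    note fc = word_value_closed[OF f]
    have eq: "elt (l # w) = elt [l] \<otimes>\<^bsub>A\<^esub> word_value f \<otimes>\<^bsub>A\<^esub> c"
      using Cons.prems l c fc by (simp add: elt_Cons[of l w] dec A.m_assoc)
    show ?case
    proof (cases "fst l = v")
      case True
      then have act: "letter_act l (word_act w []) = push (elt [(v, True)], snd l) f"
        by (simp add: letter_act_def f_def)
      have "elt [l] = (if snd l then elt [(v, True)] else inv\<^bsub>A\<^esub> elt [(v, True)])"
        using True v elt_flip[of "(v, True)"] by (cases l) auto
      then have "word_value (word_act (l # w) []) = elt [l] \<otimes>\<^bsub>A\<^esub> word_value f"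
        using v by (simp add: act A.word_eval_push words_vertex_conjugates[OF f] elt_closed)
      then show ?thesis using True eq f v_in_vertex_conjugates by (simp add: act push_closed c_def)
    next
      case False
      then have act: "letter_act l (word_act w []) = conj_word A (elt [l]) f"
        by (simp add: letter_act_def f_def)
      have "conj_word A (elt [l]) f \<in> words vertex_conjugates"
        using f False l conjugate_vertex_conjugates[of "[l]"] by (induction f) auto
      moreover have "word_value (conj_word A (elt [l]) f)
          = elt [l] \<otimes>\<^bsub>A\<^esub> word_value f \<otimes>\<^bsub>A\<^esub> inv\<^bsub>A\<^esub> elt [l]"
        using l words_vertex_conjugates[OF f] by (simp add: A.word_eval_conj_word conjugate_def)
      moreover have "elt (filter (\<lambda>l. fst l \<noteq> v) (l # w)) = elt [l] \<otimes>\<^bsub>A\<^esub> c"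
        using False l(1) filt elt_Cons[of l "filter (\<lambda>l. fst l \<noteq> v) w"] by (simp add: c_def)
      moreover have "inv\<^bsub>A\<^esub> elt [l] \<otimes>\<^bsub>A\<^esub> (elt [l] \<otimes>\<^bsub>A\<^esub> c) = c"
        using l(2) c by (simp add: A.m_assoc[symmetric])
      then have "elt [l] \<otimes>\<^bsub>A\<^esub> word_value f \<otimes>\<^bsub>A\<^esub> inv\<^bsub>A\<^esub> elt [l] \<otimes>\<^bsub>A\<^esub> (elt [l] \<otimes>\<^bsub>A\<^esub> c)
          = elt [l] \<otimes>\<^bsub>A\<^esub> word_value f \<otimes>\<^bsub>A\<^esub> c"
        using l(2) c fc by (simp add: A.m_assoc)
      ultimately show ?thesis using eq by (simp add: act)
    qed
  qed
  then show "word_act w [] \<in> words vertex_conjugates"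
    "elt w = word_value (word_act w []) \<otimes>\<^bsub>A\<^esub> elt (filter (\<lambda>l. fst l \<noteq> v) w)" by auto
qed

text \<open>
  So an element of \<open>vertex_conjugates\<close> acts as left multiplication by itself, just as \<open>v\<close> does.
\<close>

lemma word_act_conjugate:
  assumes p: "p \<in> words (V - {v})" and f: "f \<in> reduced_words"
  shows "word_act (p @ [(v, b)] @ word_inv p) f = push (conjugate A (elt p) (elt [(v, True)]), b) f"
proof -
  have c: "elt p \<in> carrier A" "elt [(v, True)] \<in> carrier A"
    using p v by (simp_all add: elt_closed words_Diff)
  have "word_act (word_inv p) f = conj_word A (inv\<^bsub>A\<^esub> elt p) f"
    using p f by (simp add: word_act_avoid elt_word_inv words_Diff)
  then have "word_act (p @ [(v, b)] @ word_inv p) f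
      = conj_word A (elt p) (push (elt [(v, True)], b) (conj_word A (inv\<^bsub>A\<^esub> elt p) f))"
    using p f c by (simp add: letter_act_def word_act_avoid push_closed A.conj_word_closed)
  also have "\<dots> = push (conjugate A (elt p) (elt [(v, True)]), b) f"
    using c f by (simp add: A.conj_word_push A.conj_word_closed A.conj_word_mult[symmetric] A.conj_word_one)
  finally show ?thesis .
qed

text \<open>
  Applied to the empty word, the product of a reduced word over \<open>vertex_conjugates\<close> rebuilds this
  word letter by letter, since pushing a letter never cancels.
\<close>

lemma ex_word_acting_as:
  assumes "r \<in> words vertex_conjugates" "reduced r"
  shows "\<exists>w\<in>words V. elt w = word_value r \<and> word_act w [] = r"
  using assms
proof (induction r)
  case Nil
  show ?case by (intro bexI[of _ "[]"]) (auto simp: elt_Nil)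
next
  case (Cons l r)
  obtain x b where l: "l = (x, b)" by (cases l)
  obtain p where p: "p \<in> words (V - {v})" "x = conjugate A (elt p) (elt [(v, True)])"
    using Cons.prems(1) l by (auto simp: vertex_conjugates_def)
  obtain w where w: "w \<in> words V" "elt w = word_value r" "word_act w [] = r"
    using Cons by auto
  define u where "u = p @ [(v, b)] @ word_inv p"
  have u: "u \<in> words V" using p(1) v by (simp add: u_def words_Diff)
  have c: "elt p \<in> carrier A" "elt [(v, True)] \<in> carrier A"
    using p v by (simp_all add: elt_closed words_Diff)
  have "elt [(v, b)] = (if b then elt [(v, True)] else inv\<^bsub>A\<^esub> elt [(v, True)])"
    using v elt_flip[of "(v, True)"] by auto
  moreover have "elt u = conjugate A (elt p) (elt [(v, b)])"
    using p(1) v by (simp add: u_def elt_append[of p "(v, b) # _"] elt_Cons[of "(v, b)" "word_inv p"] elt_closed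
      words_Diff elt_word_inv conjugate_def A.m_assoc)
  ultimately have "elt u = (if b then x else inv\<^bsub>A\<^esub> x)"
    using c by (simp add: p(2) A.conjugate_inv)
  then have "elt (u @ w) = word_value (l # r)"
    using u w by (simp add: elt_append l)
  moreover have "word_act (u @ w) [] = l # r"
    using word_act_conjugate[OF p(1), of r b] p(2) Cons.prems push_eq_Cons[of l r] words_vertex_conjugates[of r]
    by (simp add: u_def w l)
  ultimately show ?case using u w(1) by (intro bexI[of _ "u @ w"]) auto
qed

text \<open>
  The conjugates of \<open>v\<close> are free generators of the subgroup that they generate: a reduced word can be
  recovered from its product, as what this product makes of the empty word.
\<close>

lemma word_value_eq_one_iff:
  assumes "r \<in> words vertex_conjugates" "reduced r"
  shows "word_value r = \<one>\<^bsub>A\<^esub> \<longleftrightarrow> r = []"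
proof
  assume one: "word_value r = \<one>\<^bsub>A\<^esub>"
  obtain w where w: "w \<in> words V" "elt w = word_value r" "word_act w [] = r"
    using ex_word_acting_as[OF assms] by blast
  then have "pres_eq V relators w []"
    using one by (simp add: elt_Nil[symmetric] elt_eq_iff)
  from word_act_pres_eq[OF this, of "[]"] w show "r = []" by simp
qed simp

section \<open>Centerless right-angled Artin groups have many conjugates of each vertex\<close>

text \<open>
  A vertex adjacent to all others would be central, although it is not the identity.
\<close>

lemma ex_nonadjacent:
  assumes "centerless A"
  shows "\<exists>u\<in>V. u \<noteq> v \<and> {u, v} \<notin> E"
proof (rule ccontr)
  assume "\<not> ?thesis"
  then have adj: "{u, v} \<in> E" if "u \<in> V" "u \<noteq> v" for u using that by blast
  let ?v = "elt [(v, True)]"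
  have c: "?v \<in> carrier A" using v by (simp add: elt_closed)
  have comm_gen: "conjugate A (elt [(s, True)]) ?v = ?v" if "s \<in> V" for s
    using elt_edge_commute[of s v] adj that v
    by (cases "s = v") (auto simp: A.conjugate_eq_self_iff elt_closed)
  have comm: "conjugate A (elt [l]) ?v = ?v" if "fst l \<in> V" for l
  proof (cases l)
    case (Pair s b)
    have s: "elt [(s, True)] \<in> carrier A" using that Pair by (simp add: elt_closed)
    show ?thesis
    proof (cases b)
      case True
      then show ?thesis using comm_gen[of s] that Pair by simp
    next
      case False
      then have "elt [l] = inv\<^bsub>A\<^esub> elt [(s, True)]"
        using elt_flip[of "(s, True)"] that Pair by simp
      then show ?thesis
        using A.conjugate_inv_cancel(2)[OF s c] comm_gen[of s] that Pair by simp
    qed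
  qed
  have "conjugate A (elt w) ?v = ?v" if "w \<in> words V" for w
    using that
  proof (induction w)
    case Nil
    then show ?case using c by (simp add: elt_Nil A.conjugate_one)
  next
    case (Cons l w)
    then have "elt [l] \<in> carrier A" "elt w \<in> carrier A" by (simp_all add: elt_closed)
    with Cons c comm[of l] show ?case
      by (simp add: elt_Cons[of l w] A.conjugate_mult)
  qed
  then have "elt w \<otimes>\<^bsub>A\<^esub> ?v = ?v \<otimes>\<^bsub>A\<^esub> elt w" if "w \<in> words V" for w
    using that c by (simp add: A.conjugate_eq_self_iff elt_closed)
  moreover have "\<exists>w\<in>words V. g = elt w" if "g \<in> carrier A" for g
    using that by (auto simp: raag_def elt_def presented_group_carrier)
  ultimately have "?v \<in> center A" using c by (fastforce simp: center_def)
  then have "?v = \<one>\<^bsub>A\<^esub>" using assms by (auto simp: centerless_def)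
  then have "word_value [(?v, True)] = \<one>\<^bsub>A\<^esub>" by simp
  then show False using word_value_eq_one_iff[of "[(?v, True)]"] v_in_vertex_conjugates by simp
qed

text \<open>
  The conjugates of \<open>v\<close> by the powers of \<open>u\<close> are distinct. This can be seen in the affine group of the
  rational line: since \<open>u\<close> and \<open>v\<close> are not adjacent, sending \<open>u\<close> to doubling, \<open>v\<close> to translation by \<open>1\<close>
  and all other vertices to the identity preserves the relators, and \<open>u\<^sup>n v u\<^sup>-\<^sup>n\<close> becomes
  translation by \<open>2\<^sup>n\<close>.
\<close>

lemma infinite_vertex_conjugates:
  assumes u: "u \<in> V" "u \<noteq> v" "{u, v} \<notin> E"
  shows "infinite vertex_conjugates"
proof -
  let ?B = "BijGroup (UNIV :: rat set)"
  interpret B: group ?B by (rule group_BijGroup)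
  have carrier: "carrier ?B = {f. bij f}" and one: "\<one>\<^bsub>?B\<^esub> = (\<lambda>x. x)"
    by (auto simp: BijGroup_def Bij_def)
  have mult: "f \<otimes>\<^bsub>?B\<^esub> g = f \<circ> g" if "bij f" "bij g" for f g
    using that by (auto simp: BijGroup_def Bij_def compose_def)
  have bij_dbl: "bij (\<lambda>x :: rat. 2 * x)" by (rule bijI') (auto intro: exI[of _ "_ / 2"])
  have bij_hlf: "bij (\<lambda>x :: rat. x / 2)" by (rule bijI') (auto intro: exI[of _ "2 * _"])
  have bij_suc: "bij (\<lambda>x :: rat. x + 1)" by (rule bijI') (auto intro: exI[of _ "_ - 1"])
  have bij_id: "bij (\<lambda>x :: rat. x)" using bij_id by (simp add: id_def)
  define f :: "'a \<Rightarrow> rat \<Rightarrow> rat" where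
    "f s = (if s = u then (\<lambda>x. 2 * x) else if s = v then (\<lambda>x. x + 1) else (\<lambda>x. x))" for s
  have bij_f: "bij (f s)" for s by (simp add: f_def bij_dbl bij_suc bij_id)
  have f: "f \<in> V \<rightarrow> carrier ?B" using bij_f by (simp add: carrier)
  have fu: "f u = (\<lambda>x. 2 * x)" and fv: "f v = (\<lambda>x. x + 1)" using u by (simp_all add: f_def)
  have inv_fu: "inv\<^bsub>?B\<^esub> (f u) = (\<lambda>x. x / 2)"
    by (rule B.inv_equality) (auto simp: fu carrier mult one bij_dbl bij_hlf comp_def)
  have comm: "f s \<otimes>\<^bsub>?B\<^esub> f t = f t \<otimes>\<^bsub>?B\<^esub> f s" if "{s, t} \<in> E" for s t
    using that u by (auto simp: mult bij_f) (auto simp: f_def insert_commute comp_def)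
  note cong = B.word_eval_raag_cong[OF f comm]
  have bij_eval: "bij (word_eval ?B f w)" if "w \<in> words V" for w
    using B.word_eval_closed[OF f that] by (simp add: carrier)
  have up: "word_eval ?B f (replicate n (u, True)) = (\<lambda>x. 2 ^ n * x)" for n
  proof (induction n)
    case (Suc n)
    have "replicate n (u, True) \<in> words V" using u by (induction n) auto
    from bij_eval[OF this] Suc show ?case by (simp add: mult bij_f) (simp add: fu comp_def mult.assoc)
  qed (simp add: one)
  have down: "word_eval ?B f (replicate n (u, False)) = (\<lambda>x. x / 2 ^ n)" for n
  proof (induction n)
    case (Suc n)
    have "replicate n (u, False) \<in> words V" using u by (induction n) auto
    from bij_eval[OF this] Suc show ?case
      by (simp add: inv_fu mult bij_hlf) (simp add: comp_def mult.commute)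
  qed (simp add: one)
  define p where "p n = replicate n (u, True)" for n :: nat
  have inv_p: "word_inv (p n) = replicate n (u, False)" for n
    by (simp add: p_def word_inv_eq_rev_flip)
  have p: "p n \<in> words (V - {v})" for n using u unfolding p_def by (induction n) auto
  define q where "q n = p n @ [(v, True)] @ word_inv (p n)" for n
  have q: "q n \<in> words V" for n using p[of n] v by (simp add: q_def words_Diff)
  have eval_q: "word_eval ?B f (q n) 0 = 2 ^ n" for n
  proof -
    have "p n \<in> words V" "word_inv (p n) \<in> words V" using p[of n] by (simp_all add: words_Diff)
    then show ?thesis using v bij_eval[of "p n"] bij_eval[of "word_inv (p n)"] bij_f[of v]
        bij_comp[of "word_eval ?B f (word_inv (p n))" "f v"]
      by (simp add: q_def B.word_eval_append[OF f] mult)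
        (simp add: inv_p down fv up[folded p_def])
  qed
  have "elt (q n) = conjugate A (elt (p n)) (elt [(v, True)])" for n
    using p[of n] v by (simp add: q_def elt_append[of "p n" "(v, True) # _"] elt_Cons[of "(v, True)" "word_inv (p n)"]
      elt_closed words_Diff elt_word_inv conjugate_def A.m_assoc)
  then have "elt (q n) \<in> vertex_conjugates" for n using p unfolding vertex_conjugates_def by blast
  then have "range (\<lambda>n. elt (q n)) \<subseteq> vertex_conjugates" by auto
  moreover have "inj (\<lambda>n. elt (q n))"
  proof (rule injI)
    fix m n assume "elt (q m) = elt (q n)"
    then have "word_eval ?B f (q m) = word_eval ?B f (q n)"
      using q cong by (simp add: elt_eq_iff)
    then have "(2 :: rat) ^ m = 2 ^ n" using eval_q by metis
    then show "m = n" by simp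
  qed
  ultimately show ?thesis using finite_subset finite_imageD infinite_UNIV_nat by blast
qed

section \<open>Free subgroups of normal subgroups\<close>

lemma word_value_append:
  "r \<in> words vertex_conjugates \<Longrightarrow> s \<in> words vertex_conjugates \<Longrightarrow>
    word_value (r @ s) = word_value r \<otimes>\<^bsub>A\<^esub> word_value s"
  using vertex_conjugates_closed by (intro A.word_eval_append[where S = vertex_conjugates]) auto

lemma word_value_word_inv:
  "r \<in> words vertex_conjugates \<Longrightarrow> word_value (word_inv r) = inv\<^bsub>A\<^esub> word_value r"
  using vertex_conjugates_closed by (intro A.word_eval_word_inv[where S = vertex_conjugates]) auto

text \<open>
  A single non-trivial element \<open>k\<close> of \<open>M\<close> inside the free group on \<open>vertex_conjugates\<close> yields a free
  group of rank 2, since \<open>M\<close> also contains all products of conjugates of \<open>k\<close>. The two generators are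
  chosen so that \<open>reduced_substitution\<close> applies.
\<close>

lemma ex_free_hom:
  assumes M: "M \<lhd> A" and inf: "infinite vertex_conjugates"
    and r: "r \<in> words vertex_conjugates" "reduced r" "r \<noteq> []" "word_value r \<in> M"
  obtains h where "h \<in> hom (free_group (UNIV :: bool set)) A"
    "inj_on h (carrier (free_group (UNIV :: bool set)))" "h ` carrier (free_group (UNIV :: bool set)) \<subseteq> M"
proof -
  interpret M: normal M A by (rule M)
  obtain y where y: "y \<in> vertex_conjugates" "y \<noteq> fst (hd r)" "y \<noteq> fst (last r)"
    using infinite_imp_nonempty[OF Diff_infinite_finite[of "{fst (hd r), fst (last r)}", OF _ inf]] by auto
  obtain z where z: "z \<in> vertex_conjugates" "z \<noteq> fst (hd r)" "z \<noteq> fst (last r)" "z \<noteq> y"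
    using infinite_imp_nonempty[OF Diff_infinite_finite[of "{fst (hd r), fst (last r), y}", OF _ inf]] by auto
  \<comment> \<open>The words \<open>y k y\<inverse> z k z\<inverse>\<close> and \<open>y\<inverse> k y z\<inverse> k z\<close>. Together with their inverses they end in
    \<open>z\<inverse>\<close>, \<open>z\<close>, \<open>y\<inverse>\<close> and \<open>y\<close>, four distinct letters.\<close>
  define \<alpha> where "\<alpha> b = [(y, b)] @ r @ [(y, \<not> b), (z, b)] @ r @ [(z, \<not> b)]" for b :: bool
  have \<alpha>_words: "\<alpha> b \<in> words vertex_conjugates" for b using y z r by (simp add: \<alpha>_def)
  have red: "reduced (\<alpha> b)" for b
    using y z r by (auto simp: \<alpha>_def reduced_append_iff prod_eq_iff)
  have ne: "\<alpha> b \<noteq> []" for b by (simp add: \<alpha>_def)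
  have last: "last (letter_image \<alpha> (b, c)) = (if c then (z, \<not> b) else (y, \<not> b))" for b c
    by (simp add: letter_image_def last_word_inv ne) (simp add: \<alpha>_def)
  have inj: "inj (\<lambda>l. last (letter_image \<alpha> l))"
    unfolding inj_def split_paired_All last using z by (auto split: if_splits)
  have \<alpha>A: "\<alpha> b \<in> words (carrier A)" for b using words_vertex_conjugates[OF \<alpha>_words] .
  define \<theta> where "\<theta> b = word_value (\<alpha> b)" for b
  have \<theta>: "\<theta> \<in> UNIV \<rightarrow> carrier A" using word_value_closed[OF \<alpha>_words] by (simp add: \<theta>_def)
  have "\<theta> b \<in> M" for b
  proof -
    let ?y = "if b then y else inv\<^bsub>A\<^esub> y" and ?z = "if b then z else inv\<^bsub>A\<^esub> z"
    have yz: "?y \<in> carrier A" "?z \<in> carrier A" using y z vertex_conjugates_closed by auto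
    have k: "word_value r \<in> carrier A" using r by (simp add: word_value_closed)
    have "\<theta> b = (?y \<otimes>\<^bsub>A\<^esub> word_value r \<otimes>\<^bsub>A\<^esub> inv\<^bsub>A\<^esub> ?y) \<otimes>\<^bsub>A\<^esub> (?z \<otimes>\<^bsub>A\<^esub> word_value r \<otimes>\<^bsub>A\<^esub> inv\<^bsub>A\<^esub> ?z)"
      using y(1) z(1) r(1) yz k
        vertex_conjugates_closed[THEN subsetD, of y] vertex_conjugates_closed[THEN subsetD, of z]
      by (cases b) (simp_all add: \<theta>_def \<alpha>_def word_value_append A.m_assoc)
    then show ?thesis using M.inv_op_closed2[OF yz(1) r(4)] M.inv_op_closed2[OF yz(2) r(4)] by simp
  qed
  then have \<theta>M: "\<theta> \<in> UNIV \<rightarrow> M" by simp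
  obtain h where h: "h \<in> hom (free_group UNIV) A"
    and h_eq: "\<And>w. h (pres_rel UNIV {} `` {w}) = word_eval A \<theta> w"
    using A.presented_group_universal[OF \<theta>, of "{}"] by (auto simp: free_group_def words_def)
  interpret h: group_hom "free_group (UNIV :: bool set)" A h
    using h group_free_group by (simp add: group_hom_def group_hom_axioms_def A.group_axioms)
  have "C = \<one>\<^bsub>free_group UNIV\<^esub>" if C: "C \<in> carrier (free_group UNIV)" "h C = \<one>\<^bsub>A\<^esub>" for C
  proof -
    obtain s where s: "C = pres_rel UNIV {} `` {s}" "reduced s"
      using ex_reduced_word C(1) by (metis free_group_def)
    let ?s = "concat (map (letter_image \<alpha>) s)"
    have "reduced ?s" by (rule reduced_substitution) (use ne red inj s(2) in auto)
    moreover have "letter_image \<alpha> l \<in> words vertex_conjugates" for l using \<alpha>_words by (simp add: letter_image_def)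
    then have "?s \<in> words vertex_conjugates" by (induction s) auto
    moreover have "word_value ?s = \<one>\<^bsub>A\<^esub>"
      using C(2) h_eq s(1) A.word_eval_substitution[of \<alpha> s, OF \<alpha>A] by (simp add: \<theta>_def[abs_def])
    ultimately have "?s = []" using word_value_eq_one_iff by blast
    then have "s = []" using ne by (cases s) (auto simp: letter_image_def split: if_splits)
    then show ?thesis using s(1) by (simp add: free_group_def presented_group_one)
  qed
  then have "inj_on h (carrier (free_group UNIV))"
    using h.inj_on_one_iff by blast
  moreover have "h ` carrier (free_group UNIV) \<subseteq> M"
    using A.word_eval_subgroup[OF M.subgroup_axioms \<theta>M]
    by (auto simp: free_group_def presented_group_carrier h_eq)
  ultimately show thesis using that h by blast
qed

text \<open>
  The element of \<open>M\<close> at hand may have a component in the subgroup generated by the other vertices.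
  A commutator with a conjugate \<open>x\<close> of \<open>v\<close> has none, and it is non-trivial as long as \<open>x\<close> avoids two
  values at which its word could cancel.
\<close>

lemma ex_reduced_word_in_normal_subgroup:
  assumes M: "M \<lhd> A" and inf: "infinite vertex_conjugates"
    and w: "w \<in> words V" "elt w \<in> M" "elt w \<noteq> elt (filter (\<lambda>l. fst l \<noteq> v) w)"
  obtains r where "r \<in> words vertex_conjugates" "reduced r" "r \<noteq> []" "word_value r \<in> M"
proof -
  interpret M: normal M A by (rule M)
  define f where "f = word_act w []"
  define p where "p = filter (\<lambda>l. fst l \<noteq> v) w"
  have p: "p \<in> words (V - {v})" using w(1) by (auto simp: p_def words_def)
  then have c: "elt p \<in> carrier A" by (simp add: elt_closed words_Diff)
  have f: "f \<in> words vertex_conjugates" and dec: "elt w = word_value f \<otimes>\<^bsub>A\<^esub> elt p"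
    using word_act_normal_form[OF w(1)] by (simp_all add: f_def p_def)
  have red: "reduced f" using word_act_closed[OF w(1), of "[]"] by (simp add: f_def)
  have ne: "f \<noteq> []"
  proof
    assume "f = []"
    then have "elt w = \<one>\<^bsub>A\<^esub> \<otimes>\<^bsub>A\<^esub> elt p" using dec by (simp only: A.word_eval_simps)
    then show False using c w(3) unfolding p_def by (metis A.l_one)
  qed
  have fc: "word_value f \<in> carrier A" using f by (rule word_value_closed)
  obtain x where x: "x \<in> vertex_conjugates" "x \<noteq> fst (hd f)" "x \<noteq> conjugate A (inv\<^bsub>A\<^esub> elt p) (fst (last f))"
    using infinite_imp_nonempty[OF Diff_infinite_finite[
      of "{fst (hd f), conjugate A (inv\<^bsub>A\<^esub> elt p) (fst (last f))}", OF _ inf]]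
    by auto
  have xc: "x \<in> carrier A" using x(1) vertex_conjugates_closed by auto
  define x' where "x' = conjugate A (elt p) x"
  have x': "x' \<in> vertex_conjugates" using p x(1) by (simp add: x'_def conjugate_vertex_conjugates)
  have x'_last: "x' \<noteq> fst (last f)"
    using x(3) A.conjugate_inv_cancel(2)[OF c xc] by (auto simp: x'_def)
  \<comment> \<open>The commutator of \<open>f p\<close> and \<open>x\<close>, where \<open>x' = p x p\<inverse>\<close>.\<close>
  define r where "r = f @ [(x', True)] @ word_inv f @ [(x, False)]"
  have "r \<in> words vertex_conjugates" using f x' x(1) by (simp add: r_def)
  moreover have "reduced r"
    using red ne x(2) x'_last by (auto simp: r_def reduced_append_iff hd_word_inv last_word_inv prod_eq_iff)
  moreover have "word_value r = elt w \<otimes>\<^bsub>A\<^esub> (x \<otimes>\<^bsub>A\<^esub> inv\<^bsub>A\<^esub> (elt w) \<otimes>\<^bsub>A\<^esub> inv\<^bsub>A\<^esub> x)"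
    using f x(1) x' fc c xc
    by (simp add: r_def word_value_append word_value_word_inv dec A.inv_mult_group A.m_assoc)
      (simp add: x'_def conjugate_def A.m_assoc)
  then have "word_value r \<in> M" using w(2) xc M.inv_op_closed2 by simp
  moreover have "r \<noteq> []" by (simp add: r_def)
  ultimately show thesis using that by blast
qed

end

text \<open>
  The vertex \<open>v\<close> for the decomposition is the first letter of a shortest word for some \<open>m \<noteq> 1\<close> in
  \<open>M\<close>. Deleting all occurrences of \<open>v\<close> gives a shorter word, which by minimality represents an element
  other than \<open>m\<close>; so \<open>m\<close> is not in the subgroup generated by the other vertices.
\<close>

theorem normal_subgroup_raag_free:
  fixes V :: "'a set"
  assumes cl: "centerless (raag V E)" and M: "M \<lhd> raag V E" and nontriv: "M \<noteq> {\<one>\<^bsub>raag V E\<^esub>}"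
  obtains h where "h \<in> hom (free_group (UNIV :: bool set)) (raag V E)"
    "inj_on h (carrier (free_group (UNIV :: bool set)))" "h ` carrier (free_group (UNIV :: bool set)) \<subseteq> M"
proof -
  let ?R = "{commutator_word v w | v w. {v, w} \<in> E}"
  interpret M: normal M "raag V E" by (rule M)
  obtain m where m: "m \<in> M" "m \<noteq> \<one>\<^bsub>raag V E\<^esub>"
    using M.ex_nontrivial_element[OF M.subgroup_axioms nontriv] by (rule bexE)
  have mc: "m \<in> carrier (presented_group V ?R)"
    using subsetD[OF M.subset m(1)] unfolding raag_def .
  obtain w where w: "w \<in> words V" "m = pres_rel V ?R `` {w}"
    and least: "\<And>u. u \<in> words V \<Longrightarrow> m = pres_rel V ?R `` {u}
      \<Longrightarrow> length w \<le> length u"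
    by (rule ex_shortest_word[OF mc], rule that)
  have "w \<noteq> []" using w(2) m(2) by (auto simp: raag_def presented_group_one)
  then obtain l w' where lw: "w = l # w'" by (cases w) auto
  interpret raag_vertex V E "fst l" by unfold_locales (use w(1) lw in auto)
  have m_eq: "m = elt w" unfolding elt_def by (rule w(2))
  let ?p = "filter (\<lambda>k. fst k \<noteq> fst l) w"
  have "length w \<le> length u" if "u \<in> words V" "elt w = elt u" for u
    using least[of u] that by (simp add: m_eq elt_def)
  moreover have "?p \<in> words V" using w(1) by (auto simp: words_def)
  moreover have "length ?p < length w" using lw by (simp add: le_imp_less_Suc)
  ultimately have ne: "elt w \<noteq> elt ?p" using leD by blast
  have inf: "infinite vertex_conjugates" using ex_nonadjacent[OF cl] infinite_vertex_conjugates by blast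
  have wM: "elt w \<in> M" using m_eq m(1) by simp
  obtain r where r: "r \<in> words vertex_conjugates" "reduced r" "r \<noteq> []" "word_value r \<in> M"
    by (rule ex_reduced_word_in_normal_subgroup[OF M inf w(1) wM ne], rule that)
  show thesis by (rule ex_free_hom[OF M inf r], rule that)
qed

section \<open>Inner automorphisms\<close>

text \<open>
  Automorphisms in \<open>AutoGroup\<close> are extensional functions, which forces the restriction to the carrier.
\<close>

definition inner :: "('a, 'b) monoid_scheme \<Rightarrow> 'a \<Rightarrow> 'a \<Rightarrow> 'a" where
  "inner G g = (\<lambda>x\<in>carrier G. conjugate G g x)"

context group
begin

lemma AutoGroup_carrier: "carrier (AutoGroup G) = auto G"
  by (simp add: AutoGroup_def)

lemma AutoGroup_one: "\<one>\<^bsub>AutoGroup G\<^esub> = (\<lambda>x\<in>carrier G. x)"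
  by (simp add: AutoGroup_def BijGroup_def)

lemma AutoGroup_mult:
  "\<phi> \<in> auto G \<Longrightarrow> \<psi> \<in> auto G \<Longrightarrow> \<phi> \<otimes>\<^bsub>AutoGroup G\<^esub> \<psi> = compose (carrier G) \<phi> \<psi>"
  by (simp add: AutoGroup_def BijGroup_def auto_def)

lemma inner_in_auto: "g \<in> carrier G \<Longrightarrow> inner G g \<in> auto G"
proof -
  assume g: "g \<in> carrier G"
  have "inner G g \<in> hom G G" using g by (auto intro!: homI simp: inner_def conjugate_hom)
  moreover have "bij_betw (inner G g) (carrier G) (carrier G)"
    by (rule bij_betwI[where g = "inner G (inv g)"]) (use g in \<open>auto simp: inner_def conjugate_inv_cancel\<close>)
  ultimately show ?thesis by (simp add: auto_def Bij_def) (simp add: inner_def)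
qed

lemma inner_hom: "inner G \<in> hom G (AutoGroup G)"
  by (rule homI)
    (auto simp: AutoGroup_carrier inner_in_auto AutoGroup_mult, 
     auto simp: inner_def compose_def fun_eq_iff conjugate_mult)

lemma inner_conjugate:
  assumes \<phi>: "\<phi> \<in> auto G" and g: "g \<in> carrier G"
  shows "\<phi> \<otimes>\<^bsub>AutoGroup G\<^esub> inner G g \<otimes>\<^bsub>AutoGroup G\<^esub> inv\<^bsub>AutoGroup G\<^esub> \<phi> = inner G (\<phi> g)"
proof -
  interpret Aut: group "AutoGroup G" by (rule AutoGroup)
  have hom: "\<phi> \<in> hom G G" using \<phi> by (simp add: auto_def)
  interpret \<phi>: group_hom G G \<phi> by unfold_locales (rule hom)
  have carr: "\<phi> \<in> carrier (AutoGroup G)" "inner G (\<phi> g) \<in> carrier (AutoGroup G)"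
    using \<phi> g inner_in_auto by (simp_all add: AutoGroup_carrier)
  have "\<phi> \<otimes>\<^bsub>AutoGroup G\<^esub> inner G g = inner G (\<phi> g) \<otimes>\<^bsub>AutoGroup G\<^esub> \<phi>"
    using \<phi> g inner_in_auto
    by (auto simp: AutoGroup_mult inner_def compose_def fun_eq_iff conjugate_def)
  then show ?thesis using carr by (simp add: Aut.m_assoc)
qed

lemma inner_inj:
  assumes "centerless G"
  shows "inj_on (inner G) (carrier G)"
proof -
  interpret inner: group_hom G "AutoGroup G" "inner G"
    using AutoGroup inner_hom by (simp add: group_hom_def group_hom_axioms_def is_group)
  have "g = \<one>" if g: "g \<in> carrier G" "inner G g = \<one>\<^bsub>AutoGroup G\<^esub>" for g
  proof -
    have "conjugate G g x = x" if "x \<in> carrier G" for x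
      using g(2) that by (simp add: AutoGroup_one inner_def) (metis restrict_apply')
    then have "g \<in> center G" using g(1) by (simp add: center_def conjugate_eq_self_iff)
    then show ?thesis using assms by (simp add: centerless_def)
  qed
  then show ?thesis using inner.inj_on_one_iff by blast
qed

lemma normal_vimage_inner:
  assumes "N \<lhd> AutoGroup G"
  shows "{g \<in> carrier G. inner G g \<in> N} \<lhd> G"
proof -
  interpret inner: group_hom G "AutoGroup G" "inner G"
    using AutoGroup inner_hom by (simp add: group_hom_def group_hom_axioms_def is_group)
  interpret N: normal N "AutoGroup G" by (rule assms)
  have "subgroup {g \<in> carrier G. inner G g \<in> N} G"
    by (rule subgroupI) (auto intro: exI[of _ \<one>])
  then show ?thesis
    by (auto simp: normal_inv_iff N.inv_op_closed2)
qed

text \<open>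
  If \<open>\<phi>\<close> in \<open>N\<close> moves \<open>g\<close>, then \<open>\<phi>(g) g\<inverse>\<close> is a non-trivial element of the preimage.
\<close>

lemma nontrivial_vimage_inner:
  assumes N: "N \<lhd> AutoGroup G" "N \<noteq> {\<one>\<^bsub>AutoGroup G\<^esub>}"
  shows "{g \<in> carrier G. inner G g \<in> N} \<noteq> {\<one>}"
proof -
  interpret inner: group_hom G "AutoGroup G" "inner G"
    using AutoGroup inner_hom by (simp add: group_hom_def group_hom_axioms_def is_group)
  interpret N: normal N "AutoGroup G" by (rule N)
  obtain \<phi> where \<phi>: "\<phi> \<in> N" "\<phi> \<noteq> \<one>\<^bsub>AutoGroup G\<^esub>" using N(2) N.one_closed by blast
  have \<phi>a: "\<phi> \<in> auto G" using \<phi>(1) N.subset by (auto simp: AutoGroup_carrier)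
  then have ext: "\<phi> \<in> extensional (carrier G)" by (simp add: auto_def Bij_def)
  have "\<exists>g\<in>carrier G. \<phi> g \<noteq> g"
  proof (rule ccontr)
    assume "\<not> ?thesis"
    then have "\<phi> = (\<lambda>x\<in>carrier G. x)" using ext by (auto intro!: extensionalityI[of _ "carrier G"])
    then show False using \<phi>(2) by (simp add: AutoGroup_one)
  qed
  then obtain g where g: "g \<in> carrier G" "\<phi> g \<noteq> g" by blast
  have \<phi>g: "\<phi> g \<in> carrier G" using \<phi>a g(1) by (auto simp: auto_def hom_def)
  \<comment> \<open>The commutator of \<open>\<phi>\<close> with an inner automorphism, bracketed as \<open>\<phi>\<close> times a conjugate of
    \<open>\<phi>\<inverse>\<close>, lies in \<open>N\<close>; by \<open>inner_conjugate\<close> it is itself inner.\<close>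
  have "inner G (\<phi> g \<otimes> inv g) = \<phi> \<otimes>\<^bsub>AutoGroup G\<^esub>
      (inner G g \<otimes>\<^bsub>AutoGroup G\<^esub> inv\<^bsub>AutoGroup G\<^esub> \<phi> \<otimes>\<^bsub>AutoGroup G\<^esub> inv\<^bsub>AutoGroup G\<^esub> inner G g)"
    using g(1) \<phi>g N.subset \<phi>(1) inner_conjugate[OF \<phi>a g(1), symmetric]
    by (simp add: subset_iff inner.H.m_assoc)
  also have "\<dots> \<in> N"
    using \<phi>(1) N.inv_op_closed2[of "inner G g" "inv\<^bsub>AutoGroup G\<^esub> \<phi>"] g(1) by simp
  finally have "\<phi> g \<otimes> inv g \<in> {g \<in> carrier G. inner G g \<in> N}" using g(1) \<phi>g by simp
  moreover have "\<phi> g \<otimes> inv g \<noteq> \<one>" using g \<phi>g by (metis inv_solve_right' l_one one_closed)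
  ultimately show ?thesis by blast
qed

end

theorem propositionA:
  fixes V :: "'a set" and E :: "'a set set" and N :: "('a word set \<Rightarrow> 'a word set) set"
  assumes "finite_simplicial_graph V E"
    and "centerless (raag V E)"
    and "N \<lhd> AutoGroup (raag V E)"
    and "N \<noteq> {\<one>\<^bsub>AutoGroup (raag V E)\<^esub>}"
  shows "full_sized (AutoGroup (raag V E)\<lparr>carrier := N\<rparr>)"
proof -
  let ?A = "raag V E" and ?F = "free_group (UNIV :: bool set)"
  let ?Aut = "AutoGroup ?A"
  interpret A: group ?A by (rule group_raag)
  interpret N: normal N ?Aut by (rule assms(3))
  define M where "M = {g \<in> carrier ?A. inner ?A g \<in> N}"
  have M: "M \<lhd> ?A" "M \<noteq> {\<one>\<^bsub>?A\<^esub>}"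
    unfolding M_def
    by (rule A.normal_vimage_inner[OF assms(3)], rule A.nontrivial_vimage_inner[OF assms(3,4)])
  obtain h where h: "h \<in> hom ?F ?A" "inj_on h (carrier ?F)" "h ` carrier ?F \<subseteq> M"
    by (rule normal_subgroup_raag_free[OF assms(2) M], rule that)
  let ?k = "\<lambda>C. inner ?A (h C)"
  let ?N = "?Aut\<lparr>carrier := N\<rparr>"
  have N: "group ?N" using N.subgroup_is_group A.AutoGroup by blast
  have "?k \<in> hom ?F ?Aut" using hom_compose[OF h(1) A.inner_hom] by (simp add: comp_def)
  then have k: "?k \<in> hom ?F ?N" using h(3) by (auto simp: hom_def M_def)
  have inj: "inj_on ?k (carrier ?F)"
    using comp_inj_on[OF h(2) inj_on_subset[OF A.inner_inj[OF assms(2)]]] h(3)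
    by (auto simp: comp_def M_def)
  interpret k: group_hom ?F ?N ?k
    using k N group_free_group by (simp add: group_hom_def group_hom_axioms_def)
  have "?k \<in> iso ?F (?N\<lparr>carrier := ?k ` carrier ?F\<rparr>)"
    using inj k by (auto simp: iso_def hom_def bij_betw_def)
  then show ?thesis
    unfolding full_sized_def using k.img_is_subgroup by (auto simp: is_iso_def)
qed

end
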